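(* Let $G=(V,E)$ be a finite, connected and symmetric weighted graph with vertex measure $\mu$, let $h_+,h_-:V\to\mathbb{R}$ with $h_+\not\equiv0$ and $h_-\not\equiv0$, and let $c\in\mathbb{R}$. If $$\{x\in V:h_+(x)>0\}=\{x\in V:h_-(x)<0\},$$ then the equation $$-\Delta u=h_+e^{u}+h_-e^{-u}-c\quad\text{on }V$$ has at least one solution $u:V\to\mathbb{R}$. Specifically, for every function $h:V\to\mathbb{R}$ with $h\not\equiv0$ and every $c\in\mathbb{R}$, the classical sinh-Gordon equation $$-\Delta u=h\sinh u-c\quad\text{on }V$$ admits a solution.
   Context: A finite, connected and symmetric graph $G=(V,E)$ has a finite vertex set $V$ and symmetric edge weights $\omega_{xy}=\omega_{yx}\ge 0$ with $\omega_{xy}>0$ if and only if $x\sim y$ (i.e. $xy\in E$); connected means that any two vertices are joined by a path of edges. The vertex measure is a positive function $\mu:V\to(0,\infty)$, $x\mapsto\mu_x$. The Laplacian acting on $u:V\to\mathbb{R}$ is $$\Delta u(x)=\frac{1}{\mu_x}\sum_{y\sim x}\omega_{xy}\,(u(y)-u(x)).$$ *)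

theory Defs
  imports Complex_Main
begin

(* Functions on V are total HOL functions of which only the values on V matter.
   Loops are not excluded; they contribute 0 to the Laplacian. *)
locale weighted_graph =
  fixes V :: "'a set"
    and E :: "('a \<times> 'a) set"
    and \<omega> :: "'a \<Rightarrow> 'a \<Rightarrow> real"
    and \<mu> :: "'a \<Rightarrow> real"
  assumes finite_V: "finite V"
    and edges_in_V: "E \<subseteq> V \<times> V"
    and edges_sym: "sym E"
    and connected: "\<lbrakk>x \<in> V; y \<in> V\<rbrakk> \<Longrightarrow> (x, y) \<in> E\<^sup>*"
    and weight_sym: "\<lbrakk>x \<in> V; y \<in> V\<rbrakk> \<Longrightarrow> \<omega> x y = \<omega> y x"
    and weight_nonneg: "\<lbrakk>x \<in> V; y \<in> V\<rbrakk> \<Longrightarrow> \<omega> x y \<ge> 0"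
    and weight_pos_iff: "\<lbrakk>x \<in> V; y \<in> V\<rbrakk> \<Longrightarrow> \<omega> x y > 0 \<longleftrightarrow> (x, y) \<in> E"
    and measure_pos: "x \<in> V \<Longrightarrow> \<mu> x > 0"

definition laplacian ::
    "'a set \<Rightarrow> ('a \<times> 'a) set \<Rightarrow> ('a \<Rightarrow> 'a \<Rightarrow> real) \<Rightarrow> ('a \<Rightarrow> real) \<Rightarrow> ('a \<Rightarrow> real) \<Rightarrow> 'a \<Rightarrow> real"
  where "laplacian V E \<omega> \<mu> u x =
    (1 / \<mu> x) * (\<Sum>y | y \<in> V \<and> (x, y) \<in> E. \<omega> x y * (u y - u x))"

end

(* Write P for the common sign set {h\<^sub>p > 0} = {h\<^sub>m < 0}. Solutions are the critical points of
   J u = (1/2) |grad u|^2 + sum over x of \<mu> x * (c * u x - h\<^sub>p x * exp (u x) + h\<^sub>m x * exp (- u x)).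
   Off P the potential is convex, so J can be minimized over the values off P when those on P are
   held fixed; the minimum \<Phi> is upper semicontinuous and tends to -infinity, because on P the
   negative exponentials beat the quadratic Dirichlet energy. Hence \<Phi> attains its maximum, at a
   max-min point u. It is critical off P by minimality. If u x is shifted by t for some x in P and
   the values off P are then moved to the new minimizer, then convexity, criticality off P and
   nonnegativity of the Dirichlet energy bound the change of J below by a function of t alone which
   vanishes at 0 and has there the derivative of J in direction x; by maximality it is \<le> 0,
   so that derivative is 0. *)

theory Submission
  imports Defs "HOL-Analysis.Function_Topology" "HOL-Real_Asymp.Real_Asymp"
begin

section \<open>Compact boxes of functions and growth of exponentials\<close>

text \<open>Tychonoff, in the topology of pointwise convergence. Singleton factors are how values on
  part of the domain get frozen later.\<close>

lemma compact_box_fun: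
  fixes K :: "'a \<Rightarrow> 'b::topological_space set"
  assumes "\<And>x. compact (K x)"
  shows "compact {u. \<forall>x. u x \<in> K x}"
proof -
  have "compactin (product_topology (\<lambda>x. euclidean) UNIV) (PiE UNIV K)"
    using assms by (auto simp: compactin_PiE)
  moreover have "PiE UNIV K = {u. \<forall>x. u x \<in> K x}" by (auto simp: PiE_def Pi_def)
  ultimately show ?thesis
    by (simp add: euclidean_product_topology)
qed

text \<open>The bound is the tangent line of \<open>a * exp s\<close> of slope \<open>L\<close>,
  touching at \<open>s = ln (L / a)\<close>.\<close>

lemma exp_dominates_linear:
  fixes a L :: real
  assumes "a > 0" "L > 0"
  shows "\<exists>K. \<forall>s. L * s - K \<le> a * exp s"
proof (intro exI allI)
  fix s :: real
  have "L * (1 + (s - ln (L / a))) \<le> L * exp (s - ln (L / a))"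
    using assms by (intro mult_left_mono exp_ge_add_one_self) auto
  also have "\<dots> = a * exp s"
    using assms by (simp add: exp_diff)
  finally show "L * s - L * (ln (L / a) - 1) \<le> a * exp s"
    by (simp add: algebra_simps)
qed

text \<open>Everything is estimated through \<open>r = \<bar>s\<bar>\<close>: of the two
  exponentials the growing one wins against any quadratic. It serves as the anticoercivity on the
  sign set, with \<open>a\<close> and \<open>b\<close> the values of \<open>h\<^sub>p\<close> and
  \<open>- h\<^sub>m\<close>.\<close>

lemma exp_dominates_quadratic:
  fixes a b k C :: real
  assumes a: "a > 0" and b: "b > 0"
  shows "\<exists>G. \<forall>s. C * s\<^sup>2 + (k * s - a * exp s - b * exp (- s)) \<le> G - \<bar>s\<bar>"
proof -
  define g where "g = min a b"
  \<comment> \<open>The extra 1 pays for the term \<open>- \<bar>s\<bar>\<close> on the right-hand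
    side.\<close>
  define l where "l = \<bar>k\<bar> + 1"
  define q where "q = (\<lambda>r. \<bar>C\<bar> * r\<^sup>2 + l * r - g * exp r)"
  have g: "g > 0" using a b by (simp add: g_def)
  have "filterlim q at_bot at_top"
    unfolding q_def using g by real_asymp
  then have "eventually (\<lambda>r. q r \<le> 0) at_top"
    by (simp add: filterlim_at_bot)
  then obtain r0 where r0: "\<And>r. r \<ge> r0 \<Longrightarrow> q r \<le> 0"
    by (auto simp: eventually_at_top_linorder)
  define G where "G = \<bar>C\<bar> * r0\<^sup>2 + l * \<bar>r0\<bar>"
  have qG: "q r \<le> G" if "r \<ge> 0" for r
  proof (cases "r \<ge> r0")
    case True
    then have "q r \<le> 0" by (rule r0)
    also have "0 \<le> G" by (simp add: G_def l_def)
    finally show ?thesis .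
  next
    case False
    have "\<bar>C\<bar> * r\<^sup>2 \<le> \<bar>C\<bar> * r0\<^sup>2"
      using False that by (intro mult_left_mono power_mono) auto
    moreover have "l * r \<le> l * \<bar>r0\<bar>"
      using False that by (intro mult_left_mono) (auto simp: l_def)
    moreover have "g * exp r > 0" using g by simp
    ultimately show ?thesis unfolding q_def G_def by linarith
  qed
  show ?thesis
  proof (intro exI allI)
    fix s :: real
    have "g * exp \<bar>s\<bar> \<le> a * exp s + b * exp (- s)"
    proof (cases "s \<ge> 0")
      case True
      have "g * exp s \<le> a * exp s" by (intro mult_right_mono) (auto simp: g_def)
      moreover have "b * exp (- s) > 0" using b by simp
      moreover have "\<bar>s\<bar> = s" using True by simp
      ultimately show ?thesis unfolding \<open>\<bar>s\<bar> = s\<close> by linarith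
    next
      case False
      have "g * exp (- s) \<le> b * exp (- s)" by (intro mult_right_mono) (auto simp: g_def)
      moreover have "a * exp s > 0" using a by simp
      moreover have "\<bar>s\<bar> = - s" using False by simp
      ultimately show ?thesis unfolding \<open>\<bar>s\<bar> = - s\<close> by linarith
    qed
    moreover have "k * s \<le> \<bar>k\<bar> * \<bar>s\<bar>" by (metis abs_ge_self abs_mult)
    moreover have "C * s\<^sup>2 \<le> \<bar>C\<bar> * \<bar>s\<bar>\<^sup>2" by (simp add: mult_right_mono)
    moreover have "q \<bar>s\<bar> \<le> G" by (rule qG) simp
    moreover have "l * \<bar>s\<bar> = \<bar>k\<bar> * \<bar>s\<bar> + \<bar>s\<bar>" by (simp add: l_def algebra_simps)
    ultimately show "C * s\<^sup>2 + (k * s - a * exp s - b * exp (- s)) \<le> G - \<bar>s\<bar>"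
      unfolding q_def by linarith
  qed
qed

section \<open>Dirichlet energy and its expansion\<close>

context weighted_graph
begin

text \<open>Half the squared norm of the gradient. The sum runs over ordered pairs, hence 1/4 and
  not 1/2.\<close>

definition dirichlet :: "('a \<Rightarrow> real) \<Rightarrow> real"
  where "dirichlet u = (1/4) * (\<Sum>x\<in>V. \<Sum>y\<in>V. \<omega> x y * (u x - u y)\<^sup>2)"

text \<open>The partial derivative of \<open>dirichlet\<close> at the vertex \<open>x\<close>.
  Summing over all of \<open>V\<close> is harmless, as non-edges have weight 0.\<close>

definition flux :: "('a \<Rightarrow> real) \<Rightarrow> 'a \<Rightarrow> real"
  where "flux u x = (\<Sum>y\<in>V. \<omega> x y * (u x - u y))"

text \<open>The potential \<open>f\<close> is left general, so that the max-min argument is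
  independent of the exponentials.\<close>

definition energy :: "('a \<Rightarrow> real \<Rightarrow> real) \<Rightarrow> ('a \<Rightarrow> real) \<Rightarrow> real"
  where "energy f u = dirichlet u + (\<Sum>x\<in>V. \<mu> x * f x (u x))"

lemma dirichlet_nonneg: "dirichlet u \<ge> 0"
  unfolding dirichlet_def by (intro mult_nonneg_nonneg sum_nonneg) (auto simp: weight_nonneg)

lemma energy_cong: "(\<And>x. x \<in> V \<Longrightarrow> u x = v x) \<Longrightarrow> energy f u = energy f v"
  unfolding energy_def dirichlet_def by simp

lemma flux_eq_laplacian:
  assumes x: "x \<in> V"
  shows "flux u x = - \<mu> x * laplacian V E \<omega> \<mu> u x"
proof -
  have "\<omega> x y * (u x - u y) = 0" if "y \<in> V" "(x, y) \<notin> E" for y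
    using weight_pos_iff[OF x that(1)] weight_nonneg[OF x that(1)] that(2) by auto
  then have "flux u x = (\<Sum>y | y \<in> V \<and> (x, y) \<in> E. \<omega> x y * (u x - u y))"
    unfolding flux_def by (intro sum.mono_neutral_right) (auto simp: finite_V)
  also have "\<dots> = - (\<Sum>y | y \<in> V \<and> (x, y) \<in> E. \<omega> x y * (u y - u x))"
    by (simp add: sum_negf[symmetric] algebra_simps)
  finally show ?thesis
    using measure_pos[OF x] by (simp add: laplacian_def)
qed

text \<open>The expansion of a quadratic form is exact. Swapping the sums and using the symmetry of
  \<open>\<omega>\<close> makes the two halves of the cross term agree (summation by parts).\<close>

lemma dirichlet_add:
  "dirichlet (\<lambda>x. u x + z x) = dirichlet u + (\<Sum>x\<in>V. flux u x * z x) + dirichlet z"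
proof -
  have "(\<Sum>x\<in>V. \<Sum>y\<in>V. \<omega> x y * (u x - u y) * z y) =
        (\<Sum>y\<in>V. \<Sum>x\<in>V. \<omega> x y * (u x - u y) * z y)"
    by (rule sum.swap)
  also have "\<dots> = (\<Sum>y\<in>V. \<Sum>x\<in>V. - (\<omega> y x * (u y - u x) * z y))"
    by (intro sum.cong refl) (auto simp: weight_sym algebra_simps)
  also have "\<dots> = - (\<Sum>x\<in>V. flux u x * z x)"
    by (simp add: flux_def sum_negf sum_distrib_right)
  finally have 1: "(\<Sum>x\<in>V. \<Sum>y\<in>V. \<omega> x y * (u x - u y) * z y) = - (\<Sum>x\<in>V. flux u x * z x)" .
  have 2: "(\<Sum>x\<in>V. \<Sum>y\<in>V. \<omega> x y * (u x - u y) * z x) = (\<Sum>x\<in>V. flux u x * z x)"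
    by (simp add: flux_def sum_distrib_right)
  have "\<omega> x y * ((u x + z x) - (u y + z y))\<^sup>2 = \<omega> x y * (u x - u y)\<^sup>2 + \<omega> x y * (z x - z y)\<^sup>2
      + 2 * (\<omega> x y * (u x - u y) * z x) - 2 * (\<omega> x y * (u x - u y) * z y)" for x y
    by (simp add: power2_eq_square algebra_simps)
  then have "4 * dirichlet (\<lambda>x. u x + z x) = 4 * dirichlet u + 4 * dirichlet z
      + 2 * (\<Sum>x\<in>V. \<Sum>y\<in>V. \<omega> x y * (u x - u y) * z x)
      - 2 * (\<Sum>x\<in>V. \<Sum>y\<in>V. \<omega> x y * (u x - u y) * z y)"
    by (simp add: dirichlet_def sum.distrib sum_subtractf sum_distrib_left[symmetric])
  then show ?thesis unfolding 1 2 by simp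
qed

lemma energy_update:
  assumes x: "x \<in> V"
  shows "energy f (u(x := u x + t)) =
    energy f u + t * flux u x + t\<^sup>2 * dirichlet (indicator {x}) + \<mu> x * (f x (u x + t) - f x (u x))"
proof -
  define z :: "'a \<Rightarrow> real" where "z = (\<lambda>y. t * indicator {x} y)"
  have u: "u(x := u x + t) = (\<lambda>y. u y + z y)" by (auto simp: z_def)
  have "dirichlet z = t\<^sup>2 * dirichlet (indicator {x})"
    by (simp add: dirichlet_def z_def sum_distrib_left power_mult_distrib
        right_diff_distrib[symmetric] mult_ac)
  moreover have "(\<Sum>y\<in>V. flux u y * z y) = (\<Sum>y\<in>V. if y = x then t * flux u x else 0)"
    by (intro sum.cong refl) (auto simp: z_def)
  moreover have "(\<Sum>y\<in>V. \<mu> y * f y (u y + z y)) - (\<Sum>y\<in>V. \<mu> y * f y (u y))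
      = (\<Sum>y\<in>V. if y = x then \<mu> x * (f x (u x + t) - f x (u x)) else 0)"
    unfolding sum_subtractf[symmetric]
    by (intro sum.cong refl) (auto simp: z_def algebra_simps)
  ultimately show ?thesis
    unfolding u energy_def dirichlet_add using x finite_V by simp
qed

section \<open>Poincare inequality and a priori bounds\<close>

text \<open>Each edge difference is a single term of the Dirichlet sum; a path from \<open>p\<close>
  to \<open>x\<close>, which exists by connectedness, adds these bounds up by induction.\<close>

lemma poincare:
  assumes p: "p \<in> V"
  shows "\<exists>C>0. \<forall>u. (\<Sum>x\<in>V. \<mu> x * (u x - u p)\<^sup>2) \<le> C * dirichlet u"
proof -
  have edge: "\<omega> x y * (u x - u y)\<^sup>2 \<le> 4 * dirichlet u" if "x \<in> V" "y \<in> V" for u x y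
  proof -
    have "\<omega> x y * (u x - u y)\<^sup>2 \<le> (\<Sum>y\<in>V. \<omega> x y * (u x - u y)\<^sup>2)"
      using that finite_V by (intro member_le_sum) (auto simp: weight_nonneg)
    also have "\<dots> \<le> (\<Sum>x\<in>V. \<Sum>y\<in>V. \<omega> x y * (u x - u y)\<^sup>2)"
      using that finite_V
      by (intro member_le_sum[of x V "\<lambda>x. \<Sum>y\<in>V. \<omega> x y * (u x - u y)\<^sup>2"] sum_nonneg)
        (auto simp: weight_nonneg)
    finally show ?thesis by (simp add: dirichlet_def)
  qed
  have "\<exists>C\<ge>0. \<forall>u. (u x - u p)\<^sup>2 \<le> C * dirichlet u" if "(p, x) \<in> E\<^sup>*" for x
    using that
  proof (induction rule: rtrancl_induct)
    case base
    show ?case by (intro exI[of _ 0]) auto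
  next
    case (step x y)
    then obtain C where C: "C \<ge> 0" "\<And>u. (u x - u p)\<^sup>2 \<le> C * dirichlet u" by auto
    have xy: "x \<in> V" "y \<in> V" using step.hyps edges_in_V by auto
    then have w: "\<omega> x y > 0" using weight_pos_iff step.hyps by auto
    show ?case
    proof (intro exI conjI allI)
      \<comment> \<open>This constant comes from bounding the square of a difference by twice the
        sum of the squares, with the edge bound 4 / \<open>\<omega> x y\<close>.\<close>
      show "0 \<le> 2 * C + 8 / \<omega> x y" using C w by simp
      fix u
      have "(u x - u y)\<^sup>2 \<le> 4 / \<omega> x y * dirichlet u"
        using edge[OF xy, of u] w by (simp add: field_simps)
      moreover have "(u y - u p)\<^sup>2 \<le> 2 * (u x - u p)\<^sup>2 + 2 * (u x - u y)\<^sup>2"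
        using zero_le_power2[of "(u x - u p) + (u x - u y)"]
        by (simp add: power2_eq_square algebra_simps)
      ultimately show "(u y - u p)\<^sup>2 \<le> (2 * C + 8 / \<omega> x y) * dirichlet u"
        using C(2)[of u] by (simp add: distrib_right)
    qed
  qed
  then have "\<forall>x\<in>V. \<exists>C\<ge>0. \<forall>u. (u x - u p)\<^sup>2 \<le> C * dirichlet u"
    using connected p by blast
  then obtain C where C: "\<And>x. x \<in> V \<Longrightarrow> C x \<ge> 0"
      "\<And>x u. x \<in> V \<Longrightarrow> (u x - u p)\<^sup>2 \<le> C x * dirichlet u"
    by metis
  show ?thesis
  proof (intro exI conjI allI)
    have "(\<Sum>x\<in>V. \<mu> x * C x) \<ge> 0"
      by (intro sum_nonneg mult_nonneg_nonneg C less_imp_le[OF measure_pos])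
    then show "(\<Sum>x\<in>V. \<mu> x * C x) + 1 > 0" by simp
    fix u
    have "(\<Sum>x\<in>V. \<mu> x * (u x - u p)\<^sup>2) \<le> (\<Sum>x\<in>V. \<mu> x * (C x * dirichlet u))"
      by (intro sum_mono mult_left_mono C less_imp_le[OF measure_pos])
    then show "(\<Sum>x\<in>V. \<mu> x * (u x - u p)\<^sup>2) \<le> ((\<Sum>x\<in>V. \<mu> x * C x) + 1) * dirichlet u"
      using dirichlet_nonneg[of u] by (simp add: distrib_right sum_distrib_right mult.assoc)
  qed
qed

text \<open>Split \<open>c * u x\<close> into \<open>c * u p\<close> and
  \<open>c * (u x - u p)\<close>. Half of the Poincare bound absorbs the second part by completing
  the square; the other half is kept. Only the drift in \<open>u p\<close> stays
  uncontrolled.\<close>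

lemma dirichlet_linear_ge:
  assumes p: "p \<in> V"
  shows "\<exists>C>0. \<exists>K. \<forall>u. C * (\<Sum>x\<in>V. \<mu> x * (u x - u p)\<^sup>2) + c * sum \<mu> V * u p - K
    \<le> dirichlet u + (\<Sum>x\<in>V. \<mu> x * (c * u x))"
proof -
  obtain C where C: "C > 0" "\<And>u. (\<Sum>x\<in>V. \<mu> x * (u x - u p)\<^sup>2) \<le> C * dirichlet u"
    using poincare[OF p] by auto
  define a where "a = 1 / (2 * C)"
  have a: "a > 0" using C by (simp add: a_def)
  have "a * (\<Sum>x\<in>V. \<mu> x * (u x - u p)\<^sup>2) + c * sum \<mu> V * u p - sum \<mu> V * (c\<^sup>2 / (4 * a))
    \<le> dirichlet u + (\<Sum>x\<in>V. \<mu> x * (c * u x))" for u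
  proof -
    have "\<mu> x * (- (c\<^sup>2 / (4 * a))) \<le> \<mu> x * (a * (u x - u p)\<^sup>2 + c * (u x - u p))" if "x \<in> V" for x
    proof (rule mult_left_mono)
      have "0 \<le> (2 * a * (u x - u p) + c)\<^sup>2 / (4 * a)" using a by simp
      also have "\<dots> = a * (u x - u p)\<^sup>2 + c * (u x - u p) + c\<^sup>2 / (4 * a)"
        using a by (simp add: power2_eq_square field_simps)
      finally show "- (c\<^sup>2 / (4 * a)) \<le> a * (u x - u p)\<^sup>2 + c * (u x - u p)" by simp
    qed (use measure_pos[OF that] in simp)
    then have "(\<Sum>x\<in>V. \<mu> x * (- (c\<^sup>2 / (4 * a))))
        \<le> (\<Sum>x\<in>V. \<mu> x * (a * (u x - u p)\<^sup>2 + c * (u x - u p)))"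
      by (rule sum_mono)
    also have "\<dots> = a * (\<Sum>x\<in>V. \<mu> x * (u x - u p)\<^sup>2) + (\<Sum>x\<in>V. \<mu> x * (c * u x)) - c * sum \<mu> V * u p"
      by (simp add: algebra_simps sum.distrib sum_subtractf sum_distrib_left sum_distrib_right)
    finally have *: "- (sum \<mu> V * (c\<^sup>2 / (4 * a)))
        \<le> a * (\<Sum>x\<in>V. \<mu> x * (u x - u p)\<^sup>2) + (\<Sum>x\<in>V. \<mu> x * (c * u x)) - c * sum \<mu> V * u p"
      by (simp only: sum_distrib_right sum_negf mult_minus_right)
    have "2 * (a * (\<Sum>x\<in>V. \<mu> x * (u x - u p)\<^sup>2)) \<le> dirichlet u"
      using C(2)[of u] C(1) by (simp add: a_def field_simps)
    with * show ?thesis by linarith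
  qed
  with a show ?thesis by blast
qed

text \<open>Once \<open>u p\<close> is bounded, so is the drift, and the retained squares bound
  every deviation from \<open>u p\<close>.\<close>

lemma bounded_if_pinned:
  assumes p: "p \<in> V"
  shows "\<exists>R. \<forall>u. \<bar>u p\<bar> \<le> r \<longrightarrow> dirichlet u + (\<Sum>x\<in>V. \<mu> x * (c * u x)) \<le> B
    \<longrightarrow> (\<forall>x\<in>V. \<bar>u x\<bar> \<le> R)"
proof -
  obtain C K where C: "C > 0" and K: "\<And>u. C * (\<Sum>x\<in>V. \<mu> x * (u x - u p)\<^sup>2) + c * sum \<mu> V * u p - K
    \<le> dirichlet u + (\<Sum>x\<in>V. \<mu> x * (c * u x))"
    using dirichlet_linear_ge[OF p, of c] by blast
  define M where "M = B + K + \<bar>c * sum \<mu> V\<bar> * \<bar>r\<bar>"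
  \<comment> \<open>The summand 1 comes from estimating a deviation by 1 plus its square, which
    avoids square roots.\<close>
  define R where "R x = \<bar>r\<bar> + (1 + M / (C * \<mu> x))" for x
  have bound: "\<bar>u x\<bar> \<le> R x"
    if "\<bar>u p\<bar> \<le> r" "dirichlet u + (\<Sum>x\<in>V. \<mu> x * (c * u x)) \<le> B" and x: "x \<in> V" for u x
  proof -
    have "\<bar>c * sum \<mu> V * u p\<bar> \<le> \<bar>c * sum \<mu> V\<bar> * \<bar>r\<bar>"
      unfolding abs_mult[of _ "u p"] using that(1) by (intro mult_left_mono) auto
    then have 1: "C * (\<Sum>x\<in>V. \<mu> x * (u x - u p)\<^sup>2) \<le> M"
      using K[of u] that(2) unfolding M_def by linarith
    have "\<mu> x * (u x - u p)\<^sup>2 \<le> (\<Sum>x\<in>V. \<mu> x * (u x - u p)\<^sup>2)"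
      using x finite_V
      by (intro member_le_sum[of x V "\<lambda>x. \<mu> x * (u x - u p)\<^sup>2"])
        (auto intro!: mult_nonneg_nonneg less_imp_le[OF measure_pos])
    then have "C * (\<mu> x * (u x - u p)\<^sup>2) \<le> M"
      using C 1 by (smt (verit) mult_left_mono)
    then have "(u x - u p)\<^sup>2 \<le> M / (C * \<mu> x)"
      using C measure_pos[OF x] by (simp add: field_simps)
    moreover have "\<bar>u x - u p\<bar> \<le> 1 + (u x - u p)\<^sup>2"
      using zero_le_power2[of "\<bar>u x - u p\<bar> - 1/2"] by (simp add: power2_eq_square algebra_simps)
    ultimately show ?thesis using that(1) unfolding R_def by linarith
  qed
  have "\<bar>u x\<bar> \<le> Max (R ` V)"
    if "\<bar>u p\<bar> \<le> r" "dirichlet u + (\<Sum>x\<in>V. \<mu> x * (c * u x)) \<le> B" "x \<in> V" for u x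
    using order_trans[OF bound[OF that] Max_ge[of "R ` V" "R x"]] finite_V that(3) by blast
  then show ?thesis by blast
qed

section \<open>Existence of a max-min point\<close>

text \<open>The map \<open>g\<close> allows functions glued from a variable part on \<open>P\<close>
  and a fixed part elsewhere.\<close>

lemma continuous_on_energy:
  assumes f: "\<And>x. x \<in> V \<Longrightarrow> continuous_on UNIV (f x)"
    and g: "\<And>x. x \<in> V \<Longrightarrow> continuous_on S (\<lambda>u. g u x)"
  shows "continuous_on S (\<lambda>u. energy f (g u))"
  unfolding energy_def dirichlet_def
  by (intro continuous_intros g continuous_on_compose2[OF f g]) auto

text \<open>Direct method: competitors no worse than one admissible function lie in a compact box,
  after being set to 0 off \<open>V\<close>, which the energy does not see.\<close>

lemma energy_minimizer:
  assumes f: "\<And>x. x \<in> V \<Longrightarrow> continuous_on UNIV (f x)"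
    and coercive: "\<And>B. \<exists>R. \<forall>u. (\<forall>x\<in>P. u x = v x) \<longrightarrow> energy f u \<le> B \<longrightarrow> (\<forall>x\<in>V. \<bar>u x\<bar> \<le> R)"
    and P: "P \<subseteq> V"
  shows "\<exists>m. (\<forall>x\<in>P. m x = v x) \<and> (\<forall>u. (\<forall>x\<in>P. u x = v x) \<longrightarrow> energy f m \<le> energy f u)"
proof -
  define u0 where "u0 = (\<lambda>x. if x \<in> P then v x else 0)"
  obtain R where R: "\<And>u x. \<lbrakk>\<forall>x\<in>P. u x = v x; energy f u \<le> energy f u0; x \<in> V\<rbrakk> \<Longrightarrow> \<bar>u x\<bar> \<le> R"
    using coercive[of "energy f u0"] by blast
  \<comment> \<open>The absolute value keeps 0 in the interval whatever the sign of
    \<open>R\<close>, so that \<open>u0\<close> lies in the box.\<close>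
  define K where "K = {u. \<forall>x. u x \<in> (if x \<in> P then {v x} else if x \<in> V then {- \<bar>R\<bar>..\<bar>R\<bar>} else {0})}"
  have "compact K" unfolding K_def by (rule compact_box_fun) auto
  moreover have u0: "u0 \<in> K" by (auto simp: K_def u0_def)
  moreover have "continuous_on K (energy f)"
    by (rule continuous_on_energy[OF f])
      (auto intro: continuous_on_subset[OF continuous_on_product_coordinates])
  ultimately obtain m where m: "m \<in> K" "\<And>u. u \<in> K \<Longrightarrow> energy f m \<le> energy f u"
    using continuous_attains_inf[of K "energy f"] by blast
  have "energy f m \<le> energy f u" if u: "\<forall>x\<in>P. u x = v x" for u
  proof (cases "energy f u \<le> energy f u0")
    case True
    then have "(\<lambda>x. if x \<in> V then u x else 0) \<in> K"
      using P u by (auto simp: K_def dest!: R[OF u True])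
    from m(2)[OF this] show ?thesis
      by (simp cong: energy_cong)
  next
    case False
    then show ?thesis using m(2)[OF u0] by simp
  qed
  moreover have "m x = v x" if "x \<in> P" for x
    using m(1) that by (simp add: K_def) (metis singletonD)
  ultimately show ?thesis by blast
qed

text \<open>This bounds the constrained minimum from above by a test function. The Dirichlet energy
  is at most a diagonal form weighted by the degrees \<open>d\<close>, so the estimate decouples
  into one-variable bounds at the vertices of \<open>P\<close>.\<close>

lemma energy_extend_by_zero_le:
  assumes P: "P \<subseteq> V"
    and anticoercive: "\<And>x C. x \<in> P \<Longrightarrow> \<exists>G. \<forall>s. C * s\<^sup>2 + f x s \<le> G - \<bar>s\<bar>"
  shows "\<exists>G. \<forall>v. energy f (\<lambda>x. if x \<in> P then v x else 0) \<le> G - (\<Sum>x\<in>P. \<mu> x * \<bar>v x\<bar>)"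
proof -
  define d where "d x = (\<Sum>y\<in>V. \<omega> x y)" for x
  have "\<forall>x\<in>P. \<exists>G. \<forall>s. (d x / \<mu> x) * s\<^sup>2 + f x s \<le> G - \<bar>s\<bar>"
    using anticoercive by blast
  then obtain G where G: "\<And>x s. x \<in> P \<Longrightarrow> (d x / \<mu> x) * s\<^sup>2 + f x s \<le> G x - \<bar>s\<bar>"
    by metis
  have dir: "dirichlet u \<le> (\<Sum>x\<in>V. d x * (u x)\<^sup>2)" for u
  proof -
    have "4 * dirichlet u \<le> (\<Sum>x\<in>V. \<Sum>y\<in>V. 2 * (\<omega> x y * (u x)\<^sup>2) + 2 * (\<omega> x y * (u y)\<^sup>2))"
      unfolding dirichlet_def mult.assoc[symmetric]
    proof (simp, intro sum_mono)
      fix x y assume xy: "x \<in> V" "y \<in> V"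
      have "(u x - u y)\<^sup>2 \<le> 2 * (u x)\<^sup>2 + 2 * (u y)\<^sup>2"
        using zero_le_power2[of "u x + u y"] by (simp add: power2_eq_square algebra_simps)
      from mult_left_mono[OF this weight_nonneg[OF xy]]
      show "\<omega> x y * (u x - u y)\<^sup>2 \<le> 2 * \<omega> x y * (u x)\<^sup>2 + 2 * \<omega> x y * (u y)\<^sup>2"
        by (simp add: algebra_simps)
    qed
    also have "\<dots> = 2 * (\<Sum>x\<in>V. \<Sum>y\<in>V. \<omega> x y * (u x)\<^sup>2) + 2 * (\<Sum>x\<in>V. \<Sum>y\<in>V. \<omega> x y * (u y)\<^sup>2)"
      by (simp add: sum.distrib sum_distrib_left)
    also have "(\<Sum>x\<in>V. \<Sum>y\<in>V. \<omega> x y * (u y)\<^sup>2) = (\<Sum>y\<in>V. \<Sum>x\<in>V. \<omega> x y * (u y)\<^sup>2)"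
      by (rule sum.swap)
    also have "\<dots> = (\<Sum>x\<in>V. \<Sum>y\<in>V. \<omega> x y * (u x)\<^sup>2)"
      by (intro sum.cong refl) (auto simp: weight_sym)
    finally show ?thesis by (simp add: d_def sum_distrib_right)
  qed
  have "energy f (\<lambda>x. if x \<in> P then v x else 0)
      \<le> ((\<Sum>x\<in>P. \<mu> x * G x) + (\<Sum>x\<in>V - P. \<mu> x * f x 0)) - (\<Sum>x\<in>P. \<mu> x * \<bar>v x\<bar>)" for v
  proof -
    let ?u = "\<lambda>x. if x \<in> P then v x else 0"
    have "energy f ?u \<le> (\<Sum>x\<in>V. d x * (?u x)\<^sup>2 + \<mu> x * f x (?u x))"
      using dir[of ?u] by (simp add: energy_def sum.distrib)
    also have "\<dots> = (\<Sum>x\<in>P. d x * (v x)\<^sup>2 + \<mu> x * f x (v x)) + (\<Sum>x\<in>V - P. \<mu> x * f x 0)"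
      by (subst sum.subset_diff[OF P finite_V]) (simp add: add.commute)
    also have "(\<Sum>x\<in>P. d x * (v x)\<^sup>2 + \<mu> x * f x (v x)) \<le> (\<Sum>x\<in>P. \<mu> x * (G x - \<bar>v x\<bar>))"
    proof (rule sum_mono)
      fix x assume x: "x \<in> P"
      then have mu: "\<mu> x > 0" using P measure_pos by auto
      have "d x * (v x)\<^sup>2 + \<mu> x * f x (v x) = \<mu> x * ((d x / \<mu> x) * (v x)\<^sup>2 + f x (v x))"
        using mu by (simp add: distrib_left)
      also have "\<dots> \<le> \<mu> x * (G x - \<bar>v x\<bar>)"
        using mu by (intro mult_left_mono G x) auto
      finally show "d x * (v x)\<^sup>2 + \<mu> x * f x (v x) \<le> \<mu> x * (G x - \<bar>v x\<bar>)" .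
    qed
    finally show ?thesis by (simp add: right_diff_distrib sum_subtractf)
  qed
  then show ?thesis by blast
qed

text \<open>The two conclusions encode minimality of \<open>u\<close> among functions agreeing with
  it on \<open>P\<close>, and maximality of that minimum over all data \<open>v\<close> on
  \<open>P\<close>.\<close>

theorem energy_max_min:
  assumes f: "\<And>x. x \<in> V \<Longrightarrow> continuous_on UNIV (f x)"
    and coercive: "\<And>v B. \<exists>R. \<forall>u. (\<forall>x\<in>P. u x = v x) \<longrightarrow> energy f u \<le> B \<longrightarrow> (\<forall>x\<in>V. \<bar>u x\<bar> \<le> R)"
    and P: "P \<subseteq> V"
    and anticoercive: "\<And>x C. x \<in> P \<Longrightarrow> \<exists>G. \<forall>s. C * s\<^sup>2 + f x s \<le> G - \<bar>s\<bar>"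
  shows "\<exists>u. (\<forall>w. (\<forall>x\<in>P. w x = u x) \<longrightarrow> energy f u \<le> energy f w) \<and>
    (\<forall>v. \<exists>w. (\<forall>x\<in>P. w x = v x) \<and> energy f w \<le> energy f u)"
proof -
  have "\<forall>v. \<exists>m. (\<forall>x\<in>P. m x = v x) \<and> (\<forall>u. (\<forall>x\<in>P. u x = v x) \<longrightarrow> energy f m \<le> energy f u)"
    using energy_minimizer[where f = f and P = P] f coercive P by blast
  then obtain m where m: "\<And>v x. x \<in> P \<Longrightarrow> m v x = v x"
      "\<And>v u. \<forall>x\<in>P. u x = v x \<Longrightarrow> energy f (m v) \<le> energy f u"
    by metis
  define \<Phi> where "\<Phi> v = energy f (m v)" for v
  \<comment> \<open>Hence the data may be set to 0 off \<open>P\<close>, as membership in the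
    compact box \<open>K\<close> demands.\<close>
  have \<Phi>_cong: "\<Phi> v = \<Phi> v'" if "\<And>x. x \<in> P \<Longrightarrow> v x = v' x" for v v'
    unfolding \<Phi>_def using that by (intro antisym m(2)) (auto simp: m(1))
  obtain G where G: "\<And>v. energy f (\<lambda>x. if x \<in> P then v x else 0) \<le> G - (\<Sum>x\<in>P. \<mu> x * \<bar>v x\<bar>)"
    using energy_extend_by_zero_le[where f = f, OF P anticoercive] by blast
  have finP: "finite P" using P finite_V finite_subset by blast
  \<comment> \<open>The radii come from the upper bound with \<open>G\<close>: data doing at least
    as well as 0 have weighted absolute sum at most
    \<open>G - \<Phi> (\<lambda>x. 0)\<close>.\<close>
  define K where "K = {v. \<forall>x. v x \<in>
    (if x \<in> P then {- (\<bar>G - \<Phi> (\<lambda>x. 0)\<bar> / \<mu> x)..\<bar>G - \<Phi> (\<lambda>x. 0)\<bar> / \<mu> x} else {0})}"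
  have K: "compact K" unfolding K_def by (rule compact_box_fun) auto
  have zeroK: "(\<lambda>x. 0) \<in> K"
    using P measure_pos by (auto simp: K_def intro!: divide_nonneg_pos)
  have inK: "(\<lambda>x. if x \<in> P then v x else 0) \<in> K" if v: "\<Phi> (\<lambda>x. 0) \<le> \<Phi> v" for v
  proof -
    have "\<bar>v x\<bar> \<le> \<bar>G - \<Phi> (\<lambda>x. 0)\<bar> / \<mu> x" if x: "x \<in> P" for x
    proof -
      have mu: "\<mu> x > 0" using x P measure_pos by auto
      have "\<mu> x * \<bar>v x\<bar> \<le> (\<Sum>x\<in>P. \<mu> x * \<bar>v x\<bar>)"
        using x finP P
        by (intro member_le_sum[of x P "\<lambda>x. \<mu> x * \<bar>v x\<bar>"])
          (auto intro!: mult_nonneg_nonneg less_imp_le[OF measure_pos])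
      also have "\<dots> \<le> G - \<Phi> v"
        using G[of v] m(2)[of "\<lambda>x. if x \<in> P then v x else 0" v] by (simp add: \<Phi>_def)
      also have "\<dots> \<le> \<bar>G - \<Phi> (\<lambda>x. 0)\<bar>" using v by simp
      finally show ?thesis using mu by (simp add: field_simps)
    qed
    then show ?thesis by (simp add: K_def abs_le_iff minus_le_iff)
  qed
  \<comment> \<open>An infimum of continuous functions is upper semicontinuous.\<close>
  have closed: "closed {v. a \<le> \<Phi> v}" for a
  proof -
    have "{v. a \<le> \<Phi> v} = (\<Inter>w. {v. a \<le> energy f (\<lambda>x. if x \<in> P then v x else w x)})"
    proof (intro equalityI subsetI)
      fix v assume v: "v \<in> {v. a \<le> \<Phi> v}"
      have "a \<le> energy f (\<lambda>x. if x \<in> P then v x else w x)" for w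
        using v m(2)[of "\<lambda>x. if x \<in> P then v x else w x" v] by (simp add: \<Phi>_def)
      then show "v \<in> (\<Inter>w. {v. a \<le> energy f (\<lambda>x. if x \<in> P then v x else w x)})"
        by blast
    next
      fix v assume "v \<in> (\<Inter>w. {v. a \<le> energy f (\<lambda>x. if x \<in> P then v x else w x)})"
      then have "a \<le> energy f (\<lambda>x. if x \<in> P then v x else m v x)" by blast
      also have "(\<lambda>x. if x \<in> P then v x else m v x) = m v" by (auto simp: m(1))
      finally show "v \<in> {v. a \<le> \<Phi> v}" by (simp add: \<Phi>_def)
    qed
    moreover have "closed {v. a \<le> energy f (\<lambda>x. if x \<in> P then v x else w x)}" for w
    proof (intro closed_Collect_le continuous_on_energy continuous_on_const f)
      fix x
      show "continuous_on UNIV (\<lambda>v. if x \<in> P then v x else w x)"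
        by (cases "x \<in> P") auto
    qed
    ultimately show ?thesis by auto
  qed
  \<comment> \<open>A common point of these closed superlevel sets maximizes \<open>\<Phi>\<close>
    on \<open>K\<close>. By compactness finitely many sets suffice, and for those the best of the
    finitely many \<open>v\<close> works.\<close>
  have "K \<inter> (\<Inter>v\<in>K. {v'. \<Phi> v \<le> \<Phi> v'}) \<noteq> {}"
  proof (rule compact_imp_fip_image[OF K closed])
    fix I assume I: "finite I" "I \<subseteq> K"
    show "K \<inter> (\<Inter>v\<in>I. {v'. \<Phi> v \<le> \<Phi> v'}) \<noteq> {}"
    proof (cases "I = {}")
      case True
      then show ?thesis using zeroK by auto
    next
      case False
      then have "Max (\<Phi> ` I) \<in> \<Phi> ` I" using I by (intro Max_in) auto
      then obtain v where v: "v \<in> I" "\<Phi> v = Max (\<Phi> ` I)" by auto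
      then have "\<Phi> w \<le> \<Phi> v" if "w \<in> I" for w using I that by simp
      then show ?thesis using v I by blast
    qed
  qed
  then obtain v where v: "v \<in> K" "\<And>v'. v' \<in> K \<Longrightarrow> \<Phi> v' \<le> \<Phi> v" by auto
  have max: "\<Phi> v' \<le> \<Phi> v" for v'
  proof (cases "\<Phi> (\<lambda>x. 0) \<le> \<Phi> v'")
    case True
    have "\<Phi> v' = \<Phi> (\<lambda>x. if x \<in> P then v' x else 0)" by (rule \<Phi>_cong) simp
    then show ?thesis using v(2)[OF inK[OF True]] by simp
  next
    case False
    then show ?thesis using v(2)[OF zeroK] by simp
  qed
  show ?thesis
  proof (rule exI[of _ "m v"], intro conjI allI impI)
    show "energy f (m v) \<le> energy f w" if "\<forall>x\<in>P. w x = m v x" for w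
      using that by (intro m(2)) (auto simp: m(1))
    show "\<exists>w. (\<forall>x\<in>P. w x = v' x) \<and> energy f w \<le> energy f (m v)" for v'
      using max[of v'] m(1) by (auto simp: \<Phi>_def)
  qed
qed

section \<open>Max-min points are critical\<close>

text \<open>An envelope argument that never differentiates the inner minimizer. Convexity enters as
  the tangent inequality, which is what the comparison off \<open>P\<close> uses.\<close>

theorem saddle_point_is_critical:
  assumes f: "\<And>x s. x \<in> V \<Longrightarrow> (f x has_real_derivative f' x s) (at s)"
    and convex: "\<And>x r s. x \<in> V - P \<Longrightarrow> f x r + f' x r * (s - r) \<le> f x s"
    and P: "P \<subseteq> V"
    and min: "\<And>w. \<forall>x\<in>P. w x = u x \<Longrightarrow> energy f u \<le> energy f w"
    and max: "\<And>v. \<exists>w. (\<forall>x\<in>P. w x = v x) \<and> energy f w \<le> energy f u"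
    and x: "x \<in> V"
  shows "- laplacian V E \<omega> \<mu> u x + f' x (u x) = 0"
proof -
  \<comment> \<open>The quadratic coefficient \<open>q\<close> does not affect the derivative at 0.
    Off \<open>P\<close> it is the energy of an indicator; on \<open>P\<close> it is 0, since there
    the Dirichlet term is discarded.\<close>
  have deriv: "((\<lambda>t. t * flux u x + t\<^sup>2 * q + \<mu> x * (f x (u x + t) - f x (u x)))
      has_real_derivative flux u x + \<mu> x * f' x (u x)) (at 0)" if "x \<in> V" for x q
  proof -
    have "((\<lambda>t. f x (u x + t)) has_real_derivative f' x (u x)) (at 0)"
      using DERIV_shift[of "f x" "f' x (u x)" 0 "u x"] f[OF that, of "u x"] by (simp add: add.commute)
    then show ?thesis
      by (auto intro!: derivative_eq_intros)
  qed
  have off: "flux u x + \<mu> x * f' x (u x) = 0" if x: "x \<in> V - P" for x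
  proof (rule DERIV_local_min[OF deriv zero_less_one])
    show "x \<in> V" using x by simp
    show "\<forall>t. \<bar>0 - t\<bar> < 1 \<longrightarrow>
      0 * flux u x + 0\<^sup>2 * dirichlet (indicator {x}) + \<mu> x * (f x (u x + 0) - f x (u x))
      \<le> t * flux u x + t\<^sup>2 * dirichlet (indicator {x}) + \<mu> x * (f x (u x + t) - f x (u x))"
    proof (intro allI impI)
      fix t :: real
      have "energy f u \<le> energy f (u(x := u x + t))" using x by (intro min) auto
      then show "0 * flux u x + 0\<^sup>2 * dirichlet (indicator {x}) + \<mu> x * (f x (u x + 0) - f x (u x))
        \<le> t * flux u x + t\<^sup>2 * dirichlet (indicator {x}) + \<mu> x * (f x (u x + t) - f x (u x))"
        using energy_update[of x f u t] x by simp
    qed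
  qed
  have on: "flux u x + \<mu> x * f' x (u x) = 0" if x: "x \<in> P" for x
  proof (rule DERIV_local_max[OF deriv[where q = 0] zero_less_one])
    show xV: "x \<in> V" using x P by auto
    have finP: "finite P" using P finite_V finite_subset by blast
    show "\<forall>t. \<bar>0 - t\<bar> < 1 \<longrightarrow>
      t * flux u x + t\<^sup>2 * 0 + \<mu> x * (f x (u x + t) - f x (u x))
      \<le> 0 * flux u x + 0\<^sup>2 * 0 + \<mu> x * (f x (u x + 0) - f x (u x))"
    proof (intro allI impI)
      fix t :: real
      obtain w where w: "\<forall>y\<in>P. w y = (u(x := u x + t)) y" "energy f w \<le> energy f u"
        using max by blast
      define z where "z y = w y - u y" for y
      have wz: "w = (\<lambda>y. u y + z y)" by (simp add: z_def)
      have zP: "z y = (if y = x then t else 0)" if "y \<in> P" for y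
        using w(1) that by (auto simp: z_def)
      let ?g = "\<lambda>y. flux u y * z y + \<mu> y * (f y (w y) - f y (u y))"
      \<comment> \<open>Off P, convexity and criticality make every term nonnegative.\<close>
      have "0 \<le> ?g y" if y: "y \<in> V - P" for y
      proof -
        have mu: "\<mu> y > 0" using y measure_pos by auto
        have "f' y (u y) * z y \<le> f y (w y) - f y (u y)"
          using convex[OF y, of "u y" "w y"] by (simp add: z_def)
        then have "\<mu> y * (f' y (u y) * z y) \<le> \<mu> y * (f y (w y) - f y (u y))"
          using mu by (intro mult_left_mono) auto
        moreover have "flux u y = - \<mu> y * f' y (u y)" using off[OF y] by simp
        ultimately show ?thesis by simp
      qed
      then have "0 \<le> sum ?g (V - P)" by (rule sum_nonneg)
      moreover have "sum ?g P = (\<Sum>y\<in>P. if y = x then t * flux u x + \<mu> x * (f x (u x + t) - f x (u x)) else 0)"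
        by (intro sum.cong refl) (auto simp: zP wz)
      moreover have "sum ?g V = sum ?g (V - P) + sum ?g P"
        by (rule sum.subset_diff[OF P finite_V])
      \<comment> \<open>The left side is at most 0 by the choice of \<open>w\<close>. On the right,
        the Dirichlet term and the part off \<open>P\<close> are nonnegative, so the part on
        \<open>P\<close>, a function of \<open>t\<close> alone, is at most 0.\<close>
      moreover have "energy f w - energy f u = dirichlet z + sum ?g V"
        unfolding energy_def wz dirichlet_add
        by (simp add: sum.distrib sum_subtractf right_diff_distrib)
      ultimately have "t * flux u x + \<mu> x * (f x (u x + t) - f x (u x)) \<le> 0"
        using dirichlet_nonneg[of z] w(2) x finP by simp
      then show "t * flux u x + t\<^sup>2 * 0 + \<mu> x * (f x (u x + t) - f x (u x))
        \<le> 0 * flux u x + 0\<^sup>2 * 0 + \<mu> x * (f x (u x + 0) - f x (u x))" by simp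
    qed
  qed
  have "flux u x + \<mu> x * f' x (u x) = 0" using on off x by blast
  then have "\<mu> x * (- laplacian V E \<omega> \<mu> u x + f' x (u x)) = 0"
    by (simp add: flux_eq_laplacian[OF x] algebra_simps)
  then show ?thesis using measure_pos[OF x] by simp
qed

section \<open>The sinh-Gordon potential\<close>

text \<open>If \<open>P\<close> is nonempty, the prescribed values pin one vertex. If
  \<open>P\<close> is empty, \<open>nz\<close> gives a vertex \<open>a\<close> whose exponential
  stops \<open>u a\<close> from going up and a vertex \<open>b\<close> whose exponential stops
  \<open>u b\<close> from going down; the Dirichlet energy ties the two together.\<close>

lemma sinh_gordon_coercive:
  fixes h\<^sub>p h\<^sub>m :: "'a \<Rightarrow> real" and c :: real
  defines "f \<equiv> \<lambda>x s. c * s - h\<^sub>p x * exp s + h\<^sub>m x * exp (- s)"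
  assumes hp: "\<And>x. x \<in> V - P \<Longrightarrow> h\<^sub>p x \<le> 0" and hm: "\<And>x. x \<in> V - P \<Longrightarrow> h\<^sub>m x \<ge> 0"
    and P: "P \<subseteq> V"
    and nz: "\<exists>x\<in>V. h\<^sub>p x \<noteq> 0" "\<exists>x\<in>V. h\<^sub>m x \<noteq> 0"
  shows "\<exists>R. \<forall>u. (\<forall>x\<in>P. u x = v x) \<longrightarrow> energy f u \<le> B \<longrightarrow> (\<forall>x\<in>V. \<bar>u x\<bar> \<le> R)"
proof -
  define g where "g x s = h\<^sub>m x * exp (- s) - h\<^sub>p x * exp s" for x and s :: real
  define L where "L u = dirichlet u + (\<Sum>x\<in>V. \<mu> x * (c * u x))" for u
  have energy: "energy f u = L u + (\<Sum>x\<in>V. \<mu> x * g x (u x))" for u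
    by (simp add: energy_def f_def L_def g_def sum.distrib[symmetric] algebra_simps)
  have g: "g x s \<ge> 0" if "x \<in> V - P" for x s
    using mult_nonpos_nonneg[OF hp[OF that], of "exp s"] mult_nonneg_nonneg[OF hm[OF that], of "exp (- s)"]
    by (simp add: g_def)
  show ?thesis
  proof (cases "P = {}")
    case False
    then obtain p where p: "p \<in> P" by auto
    have "L u \<le> B - (\<Sum>x\<in>P. \<mu> x * g x (v x))" if "\<forall>x\<in>P. u x = v x" "energy f u \<le> B" for u
    proof -
      have "0 \<le> (\<Sum>x\<in>V - P. \<mu> x * g x (u x))"
        using g measure_pos by (intro sum_nonneg mult_nonneg_nonneg) (auto simp: less_imp_le)
      moreover have "(\<Sum>x\<in>V. \<mu> x * g x (u x)) = (\<Sum>x\<in>V - P. \<mu> x * g x (u x)) + (\<Sum>x\<in>P. \<mu> x * g x (u x))"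
        by (rule sum.subset_diff[OF P finite_V])
      moreover have "(\<Sum>x\<in>P. \<mu> x * g x (u x)) = (\<Sum>x\<in>P. \<mu> x * g x (v x))"
        using that(1) by (intro sum.cong) auto
      ultimately show ?thesis using that(2) energy[of u] by linarith
    qed
    moreover obtain R where "\<And>u. \<bar>u p\<bar> \<le> \<bar>v p\<bar> \<Longrightarrow> L u \<le> B - (\<Sum>x\<in>P. \<mu> x * g x (v x))
        \<Longrightarrow> (\<forall>x\<in>V. \<bar>u x\<bar> \<le> R)"
      using bounded_if_pinned[of p "\<bar>v p\<bar>" c "B - (\<Sum>x\<in>P. \<mu> x * g x (v x))"] p P
      unfolding L_def by blast
    ultimately show ?thesis using p by (intro exI[of _ R]) auto
  next
    case True
    obtain a b where a: "a \<in> V" "h\<^sub>p a \<noteq> 0" and b: "b \<in> V" "h\<^sub>m b \<noteq> 0" using nz by auto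
    have mu: "\<mu> a > 0" "\<mu> b > 0" using a b measure_pos by auto
    have ha: "- h\<^sub>p a > 0" using hp[of a] a True by simp
    have hb: "h\<^sub>m b > 0" using hm[of b] b True by simp
    have g': "\<mu> x * g x (u x) \<le> (\<Sum>x\<in>V. \<mu> x * g x (u x))" if "x \<in> V" for x u
      using that finite_V g True measure_pos
      by (intro member_le_sum[of x V "\<lambda>x. \<mu> x * g x (u x)"]) (auto intro!: mult_nonneg_nonneg simp: less_imp_le)
    have g0: "0 \<le> (\<Sum>x\<in>V. \<mu> x * g x (u x))" for u
      using g True measure_pos by (intro sum_nonneg mult_nonneg_nonneg) (auto simp: less_imp_le)
    have ga: "\<mu> a * (- h\<^sub>p a) * exp (u a) \<le> (\<Sum>x\<in>V. \<mu> x * g x (u x))" for u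
    proof -
      have "- h\<^sub>p a * exp (u a) \<le> g a (u a)"
        using hm[of a] a True by (simp add: g_def)
      then have "\<mu> a * (- h\<^sub>p a * exp (u a)) \<le> \<mu> a * g a (u a)"
        using mu by (intro mult_left_mono) auto
      then show ?thesis using g'[OF a(1), of u] by (simp add: mult.assoc)
    qed
    have gb: "\<mu> b * h\<^sub>m b * exp (- u b) \<le> (\<Sum>x\<in>V. \<mu> x * g x (u x))" for u
    proof -
      have "h\<^sub>m b * exp (- u b) \<le> g b (u b)"
        using hp[of b] b True by (simp add: g_def mult_nonpos_nonneg)
      then have "\<mu> b * (h\<^sub>m b * exp (- u b)) \<le> \<mu> b * g b (u b)" using mu by simp
      then show ?thesis using g'[OF b(1), of u] by (simp add: mult.assoc)
    qed
    \<comment> \<open>Slope \<open>k\<close> beats the drift \<open>c * sum \<mu> V\<close> in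
      either direction, with a margin of at least 1.\<close>
    define k where "k = \<bar>c * sum \<mu> V\<bar> + 1"
    have k: "k > 0" by (simp add: k_def)
    obtain C K where C: "C > 0" and K: "\<And>u. C * (\<Sum>x\<in>V. \<mu> x * (u x - u a)\<^sup>2) + c * sum \<mu> V * u a - K \<le> L u"
      using dirichlet_linear_ge[OF a(1), of c] unfolding L_def by blast
    obtain K1 where K1: "\<And>s. k * s - K1 \<le> \<mu> a * (- h\<^sub>p a) * exp s"
      using exp_dominates_linear[OF mult_pos_pos[OF mu(1) ha] k] by blast
    obtain K2 where K2: "\<And>s. k * s - K2 \<le> \<mu> b * h\<^sub>m b * exp s"
      using exp_dominates_linear[OF mult_pos_pos[OF mu(2) hb] k] by blast
    define e where "e = C * \<mu> b"
    have e: "e > 0" using C mu by (simp add: e_def)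
    have *: "e * (u b - u a)\<^sup>2 + c * sum \<mu> V * u a - K \<le> L u" for u
    proof -
      have "\<mu> b * (u b - u a)\<^sup>2 \<le> (\<Sum>x\<in>V. \<mu> x * (u x - u a)\<^sup>2)"
        using b finite_V
        by (intro member_le_sum[of b V "\<lambda>x. \<mu> x * (u x - u a)\<^sup>2"])
          (auto intro!: mult_nonneg_nonneg less_imp_le[OF measure_pos])
      then have "C * (\<mu> b * (u b - u a)\<^sup>2) \<le> C * (\<Sum>x\<in>V. \<mu> x * (u x - u a)\<^sup>2)"
        using C by simp
      then show ?thesis using K[of u] by (simp add: e_def mult.assoc)
    qed
    define r where "r = \<bar>B + K + K1\<bar> + \<bar>B + K + K2 + k\<^sup>2 / (4 * e)\<bar>"
    have pinned: "\<bar>u a\<bar> \<le> r" if "energy f u \<le> B" for u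
    proof (cases "u a \<ge> 0")
      case True
      have "e * (u b - u a)\<^sup>2 \<ge> 0" using e by simp
      then have "(c * sum \<mu> V + k) * u a \<le> B + K + K1"
        using *[of u] K1[of "u a"] ga[of u] that energy[of u] by (simp add: distrib_right)
      moreover have "1 * u a \<le> (c * sum \<mu> V + k) * u a"
        using True by (intro mult_right_mono) (auto simp: k_def)
      ultimately show ?thesis using True unfolding r_def by linarith
    next
      case False
      \<comment> \<open>Completing the square trades \<open>- k * u b\<close> for
        \<open>- k * u a\<close> at the cost \<open>k\<^sup>2 / (4 * e)\<close>, carrying the lower
        bound at \<open>b\<close> over to \<open>a\<close>.\<close>
      have "0 \<le> (2 * e * (u b - u a) - k)\<^sup>2 / (4 * e)" using e by simp
      also have "\<dots> = e * (u b - u a)\<^sup>2 - k * (u b - u a) + k\<^sup>2 / (4 * e)"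
        using e by (simp add: power2_eq_square field_simps)
      finally have "(k - c * sum \<mu> V) * (- u a) \<le> B + K + K2 + k\<^sup>2 / (4 * e)"
        using *[of u] K2[of "- u b"] gb[of u] that energy[of u] by (simp add: algebra_simps)
      moreover have "1 * (- u a) \<le> (k - c * sum \<mu> V) * (- u a)"
        using False by (intro mult_right_mono) (auto simp: k_def)
      ultimately show ?thesis using False unfolding r_def by linarith
    qed
    have "L u \<le> B" if "energy f u \<le> B" for u using that energy[of u] g0[of u] by linarith
    then show ?thesis
      using bounded_if_pinned[OF a(1), of r c B] pinned unfolding L_def by blast
  qed
qed

text \<open>Equality of the sign sets gives every vertex one of two types: on \<open>P\<close> both
  exponentials enter the potential with negative coefficients, off \<open>P\<close> both with
  nonnegative ones. This yields anticoercivity and convexity respectively.\<close>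

theorem sinh_gordon_solvable:
  fixes h\<^sub>p h\<^sub>m :: "'a \<Rightarrow> real" and c :: real
  assumes nz: "\<exists>x\<in>V. h\<^sub>p x \<noteq> 0" "\<exists>x\<in>V. h\<^sub>m x \<noteq> 0"
    and signs: "{x \<in> V. h\<^sub>p x > 0} = {x \<in> V. h\<^sub>m x < 0}"
  shows "\<exists>u. \<forall>x\<in>V. - laplacian V E \<omega> \<mu> u x = h\<^sub>p x * exp (u x) + h\<^sub>m x * exp (- u x) - c"
proof -
  define P where "P = {x \<in> V. h\<^sub>p x > 0}"
  define f where "f = (\<lambda>x s. c * s - h\<^sub>p x * exp s + h\<^sub>m x * exp (- s))"
  define f' where "f' = (\<lambda>x s. c - h\<^sub>p x * exp s - h\<^sub>m x * exp (- s))"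
  have P: "P \<subseteq> V" by (auto simp: P_def)
  have on: "h\<^sub>p x > 0" "- h\<^sub>m x > 0" if "x \<in> P" for x using that signs by (auto simp: P_def)
  have off: "h\<^sub>p x \<le> 0" "h\<^sub>m x \<ge> 0" if "x \<in> V - P" for x
    using that signs by (auto simp: P_def not_less[symmetric])
  have deriv: "(f x has_real_derivative f' x s) (at s)" for x s
    unfolding f_def f'_def by (auto intro!: derivative_eq_intros)
  have cont: "continuous_on UNIV (f x)" for x
    unfolding f_def by (intro continuous_intros)
  have convex: "f x r + f' x r * (s - r) \<le> f x s" if x: "x \<in> V - P" for x r s
  proof -
    have "exp r * (1 + (s - r)) \<le> exp r * exp (s - r)"
      by (intro mult_left_mono exp_ge_add_one_self) auto
    then have "exp r * (1 + (s - r)) \<le> exp s" by (simp add: exp_diff)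
    then have 1: "(- h\<^sub>p x) * (exp r * (1 + (s - r))) \<le> (- h\<^sub>p x) * exp s"
      using off[OF x] by (intro mult_left_mono) auto
    have "exp (-r) * (1 + (r - s)) \<le> exp (-r) * exp (r - s)"
      by (intro mult_left_mono exp_ge_add_one_self) auto
    then have "exp (-r) * (1 + (r - s)) \<le> exp (-s)" by (simp flip: exp_add)
    then have 2: "h\<^sub>m x * (exp (-r) * (1 + (r - s))) \<le> h\<^sub>m x * exp (-s)"
      using off[OF x] by (intro mult_left_mono) auto
    show ?thesis using 1 2 unfolding f_def f'_def by (simp add: algebra_simps)
  qed
  have "\<exists>G. \<forall>s. C * s\<^sup>2 + f x s \<le> G - \<bar>s\<bar>" if "x \<in> P" for x C
    using exp_dominates_quadratic[OF on[OF that], of C c] by (simp add: f_def)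
  then have "\<exists>u. (\<forall>w. (\<forall>x\<in>P. w x = u x) \<longrightarrow> energy f u \<le> energy f w) \<and>
      (\<forall>v. \<exists>w. (\<forall>x\<in>P. w x = v x) \<and> energy f w \<le> energy f u)"
    using sinh_gordon_coercive[OF off P nz, where c = c, folded f_def]
    by (intro energy_max_min cont P) auto
  then obtain u where "\<And>w. \<forall>x\<in>P. w x = u x \<Longrightarrow> energy f u \<le> energy f w"
      "\<And>v. \<exists>w. (\<forall>x\<in>P. w x = v x) \<and> energy f w \<le> energy f u"
    by blast
  then have "\<forall>x\<in>V. - laplacian V E \<omega> \<mu> u x + f' x (u x) = 0"
    using saddle_point_is_critical[of f f' P u] deriv convex P by blast
  then show ?thesis by (intro exI[of _ u]) (force simp: f'_def)
qed

end

theorem corollary2p3: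
  fixes V :: "'a set"
    and E :: "('a \<times> 'a) set"
    and \<omega> :: "'a \<Rightarrow> 'a \<Rightarrow> real"
    and \<mu> :: "'a \<Rightarrow> real"
  assumes "weighted_graph V E \<omega> \<mu>"
  shows "(\<forall>(h\<^sub>p :: 'a \<Rightarrow> real) (h\<^sub>m :: 'a \<Rightarrow> real) (c :: real).
            (\<exists>x\<in>V. h\<^sub>p x \<noteq> 0) \<longrightarrow> (\<exists>x\<in>V. h\<^sub>m x \<noteq> 0) \<longrightarrow>
            {x \<in> V. h\<^sub>p x > 0} = {x \<in> V. h\<^sub>m x < 0} \<longrightarrow>
            (\<exists>u :: 'a \<Rightarrow> real. \<forall>x\<in>V.
               - laplacian V E \<omega> \<mu> u x = h\<^sub>p x * exp (u x) + h\<^sub>m x * exp (- u x) - c))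
       \<and> (\<forall>(h :: 'a \<Rightarrow> real) (c :: real).
            (\<exists>x\<in>V. h x \<noteq> 0) \<longrightarrow>
            (\<exists>u :: 'a \<Rightarrow> real. \<forall>x\<in>V.
               - laplacian V E \<omega> \<mu> u x = h x * sinh (u x) - c))"
proof (intro conjI allI impI)
  interpret weighted_graph V E \<omega> \<mu> by fact
  show "\<exists>u. \<forall>x\<in>V. - laplacian V E \<omega> \<mu> u x = h\<^sub>p x * exp (u x) + h\<^sub>m x * exp (- u x) - c"
    if "\<exists>x\<in>V. h\<^sub>p x \<noteq> 0" "\<exists>x\<in>V. h\<^sub>m x \<noteq> 0" "{x \<in> V. h\<^sub>p x > 0} = {x \<in> V. h\<^sub>m x < 0}"
    for h\<^sub>p h\<^sub>m c
    using sinh_gordon_solvable[OF that] .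
  show "\<exists>u. \<forall>x\<in>V. - laplacian V E \<omega> \<mu> u x = h x * sinh (u x) - c"
    if "\<exists>x\<in>V. h x \<noteq> 0" for h c
    \<comment> \<open>Writing sinh by exponentials gives coefficients of opposite sign, so both sign
      sets are the set where \<open>h\<close> is positive.\<close>
    using sinh_gordon_solvable[of "\<lambda>x. h x / 2" "\<lambda>x. - h x / 2" c] that
    by (simp add: sinh_def field_simps)
qed

end
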